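(* Every monoid containing a submonoid isomorphic to the bicyclic monoid is non-surjunctive (i.e., not surjunctive). In particular, the bicyclic monoid is non-surjunctive.
   Context: The bicyclic monoid is the monoid $B$ with presentation $\langle x,y : xy = 1\rangle$. A submonoid of a monoid $M$ is a subset containing $1_M$ and closed under multiplication. Let $M$ be a monoid and $A$ a set. The set $A^M$ of all maps $x\colon M\to A$ carries the shift action of $M$ given by $(mx)(m') := x(m'm)$ for $m,m'\in M$, and the prodiscrete uniform structure, for which a base of entourages is given by the sets $W_F := \{(x,y)\in A^M\times A^M : x|_F = y|_F\}$, $F$ running over all finite subsets of $M$. A cellular automaton over $M$ with alphabet $A$ is a map $\tau\colon A^M\to A^M$ that is $M$-equivariant ($\tau(mx)=m\tau(x)$ for all $m\in M$, $x\in A^M$) and uniformly continuous. The monoid $M$ is called surjunctive if, for every finite set $A$, every injective cellular automaton $\tau\colon A^M\to A^M$ is surjective. *)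

theory Defs
  imports "HOL-Algebra.Group"
begin

section \<open>Monoid presentations and the bicyclic monoid\<close>

text \<open>The smallest congruence containing \<open>R\<close> on the free monoid of words over the type \<open>'g\<close>.\<close>

inductive_set word_cong :: "('g list \<times> 'g list) set \<Rightarrow> ('g list \<times> 'g list) set"
  for R :: "('g list \<times> 'g list) set" where
  rel: "(u, v) \<in> R \<Longrightarrow> (u, v) \<in> word_cong R"
| refl: "(u, u) \<in> word_cong R"
| sym: "(u, v) \<in> word_cong R \<Longrightarrow> (v, u) \<in> word_cong R"
| trans: "(u, v) \<in> word_cong R \<Longrightarrow> (v, w) \<in> word_cong R \<Longrightarrow> (u, w) \<in> word_cong R"
| mult: "(u, v) \<in> word_cong R \<Longrightarrow> (u', v') \<in> word_cong R \<Longrightarrow> (u @ u', v @ v') \<in> word_cong R"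

definition presented_monoid :: "('g list \<times> 'g list) set \<Rightarrow> 'g list set monoid" where
  "presented_monoid R =
     \<lparr>carrier = UNIV // word_cong R,
      mult = (\<lambda>U V. \<Union>u\<in>U. \<Union>v\<in>V. word_cong R `` {u @ v}),
      one = word_cong R `` {[]}\<rparr>"

datatype bicyclic_gen = X | Y

definition bicyclic_monoid :: "bicyclic_gen list set monoid" where
  "bicyclic_monoid = presented_monoid {([X, Y], [])}"

lemma equiv_word_cong: "equiv UNIV (word_cong R)"
  by (intro equivI refl_onI symI transI)
    (auto intro: word_cong.refl word_cong.sym word_cong.trans)

lemma presented_monoid_mult:
  "word_cong R `` {u} \<otimes>\<^bsub>presented_monoid R\<^esub> word_cong R `` {v} = word_cong R `` {u @ v}"
proof -
  have eq: "word_cong R `` {u' @ v'} = word_cong R `` {u @ v}"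
    if "u' \<in> word_cong R `` {u}" "v' \<in> word_cong R `` {v}" for u' v'
    by (rule equiv_class_eq[OF equiv_word_cong])
      (use that in \<open>auto intro: word_cong.sym[OF word_cong.mult]\<close>)
  have ne: "word_cong R `` {w} \<noteq> {}" for w
    using word_cong.refl[of w R] by blast
  have "word_cong R `` {u} \<otimes>\<^bsub>presented_monoid R\<^esub> word_cong R `` {v} =
      (\<Union>u'\<in>word_cong R `` {u}. \<Union>v'\<in>word_cong R `` {v}. word_cong R `` {u' @ v'})"
    by (simp add: presented_monoid_def)
  also have "\<dots> = (\<Union>u'\<in>word_cong R `` {u}. \<Union>v'\<in>word_cong R `` {v}. word_cong R `` {u @ v})"
    by (intro SUP_cong HOL.refl eq)
  also have "\<dots> = word_cong R `` {u @ v}"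
    by (simp only: SUP_const[OF ne])
  finally show ?thesis .
qed

lemma monoid_presented_monoid: "monoid (presented_monoid R)"
proof -
  have carr: "carrier (presented_monoid R) = range (\<lambda>u. word_cong R `` {u})"
    by (auto simp: presented_monoid_def quotient_def)
  have one: "\<one>\<^bsub>presented_monoid R\<^esub> = word_cong R `` {[]}"
    by (simp add: presented_monoid_def)
  show ?thesis
    by (rule monoidI) (auto simp: carr one presented_monoid_mult)
qed

lemma monoid_bicyclic_monoid: "monoid bicyclic_monoid"
  by (simp add: bicyclic_monoid_def monoid_presented_monoid)


section \<open>Cellular automata over monoids\<close>

text \<open>A map from the carrier of \<open>M\<close> to \<open>A\<close> is represented by an extensional function.\<close>

definition configs :: "('a, 'm) monoid_scheme \<Rightarrow> 'b set \<Rightarrow> ('a \<Rightarrow> 'b) set" where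
  "configs M A = carrier M \<rightarrow>\<^sub>E A"

definition shift :: "('a, 'm) monoid_scheme \<Rightarrow> 'a \<Rightarrow> ('a \<Rightarrow> 'b) \<Rightarrow> 'a \<Rightarrow> 'b" where
  "shift M m x = (\<lambda>m'\<in>carrier M. x (m' \<otimes>\<^bsub>M\<^esub> m))"

definition agree_on ::
  "('a, 'm) monoid_scheme \<Rightarrow> 'b set \<Rightarrow> 'a set \<Rightarrow> (('a \<Rightarrow> 'b) \<times> ('a \<Rightarrow> 'b)) set" where
  "agree_on M A F = {(x, y) \<in> configs M A \<times> configs M A. restrict x F = restrict y F}"

text \<open>The filter of entourages.\<close>

definition prodiscrete ::
  "('a, 'm) monoid_scheme \<Rightarrow> 'b set \<Rightarrow> (('a \<Rightarrow> 'b) \<times> ('a \<Rightarrow> 'b)) filter" where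
  "prodiscrete M A = (INF F\<in>{F. finite F \<and> F \<subseteq> carrier M}. principal (agree_on M A F))"

definition cellular_automaton ::
  "('a, 'm) monoid_scheme \<Rightarrow> 'b set \<Rightarrow> (('a \<Rightarrow> 'b) \<Rightarrow> 'a \<Rightarrow> 'b) \<Rightarrow> bool" where
  "cellular_automaton M A \<tau> \<longleftrightarrow>
     \<tau> \<in> configs M A \<rightarrow> configs M A \<and>
     (\<forall>m\<in>carrier M. \<forall>x\<in>configs M A. \<tau> (shift M m x) = shift M m (\<tau> x)) \<and>
     (LIM (x, y) prodiscrete M A. (\<tau> x, \<tau> y) :> prodiscrete M A)"

text \<open>Finite alphabets are taken to be sets of natural numbers, since a definition cannot quantify
  over types; lemma \<open>surjunctive_finite_alphabet\<close> shows that this covers finite sets of any type.\<close>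

definition surjunctive :: "('a, 'm) monoid_scheme \<Rightarrow> bool" where
  "surjunctive M \<longleftrightarrow>
     (\<forall>(A :: nat set) \<tau>. finite A \<longrightarrow> cellular_automaton M A \<tau> \<longrightarrow>
        inj_on \<tau> (configs M A) \<longrightarrow> \<tau> ` configs M A = configs M A)"

lemma restrict_eq_iff_ball: "restrict x F = restrict y F \<longleftrightarrow> (\<forall>m\<in>F. x m = y m)"
  by (metis restrict_apply' restrict_ext)

lemma eventually_prodiscrete:
  "eventually P (prodiscrete M A) \<longleftrightarrow>
     (\<exists>F. finite F \<and> F \<subseteq> carrier M \<and> (\<forall>p\<in>agree_on M A F. P p))"
proof -
  have agree: "agree_on M A F = {(x, y) \<in> configs M A \<times> configs M A. \<forall>m\<in>F. x m = y m}" for F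
    by (simp only: agree_on_def restrict_eq_iff_ball)
  have "\<exists>H\<in>{F. finite F \<and> F \<subseteq> carrier M}.
      principal (agree_on M A H) \<le> inf (principal (agree_on M A F)) (principal (agree_on M A G))"
    if "F \<in> {F. finite F \<and> F \<subseteq> carrier M}" "G \<in> {F. finite F \<and> F \<subseteq> carrier M}" for F G
  proof (rule bexI[of _ "F \<union> G"])
    show "principal (agree_on M A (F \<union> G))
        \<le> inf (principal (agree_on M A F)) (principal (agree_on M A G))"
      by (auto simp: agree)
  qed (use that in auto)
  then show ?thesis
    unfolding prodiscrete_def
    by (subst eventually_INF_base) (auto simp: eventually_principal)
qed

lemma cellular_automaton_alt:
  "cellular_automaton M A \<tau> \<longleftrightarrow>
     \<tau> \<in> configs M A \<rightarrow> configs M A \<and>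
     (\<forall>m\<in>carrier M. \<forall>x\<in>configs M A. \<tau> (shift M m x) = shift M m (\<tau> x)) \<and>
     (\<forall>F. finite F \<and> F \<subseteq> carrier M \<longrightarrow> (\<exists>E. finite E \<and> E \<subseteq> carrier M \<and>
        (\<forall>x\<in>configs M A. \<forall>y\<in>configs M A.
           (\<forall>m\<in>E. x m = y m) \<longrightarrow> (\<forall>m\<in>F. \<tau> x m = \<tau> y m))))"
proof (cases "\<tau> \<in> configs M A \<rightarrow> configs M A")
  case True
  have agree: "(x, y) \<in> agree_on M A F \<longleftrightarrow>
      x \<in> configs M A \<and> y \<in> configs M A \<and> (\<forall>m\<in>F. x m = y m)" for x y F
    by (simp add: agree_on_def restrict_eq_iff_ball)
  have "(LIM (x, y) prodiscrete M A. (\<tau> x, \<tau> y) :> prodiscrete M A) \<longleftrightarrow>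
      (\<forall>F\<in>{F. finite F \<and> F \<subseteq> carrier M}.
        eventually (\<lambda>(x, y). (\<tau> x, \<tau> y) \<in> agree_on M A F) (prodiscrete M A))"
    by (subst (1) prodiscrete_def)
      (simp only: filterlim_INF filterlim_principal case_prod_unfold)
  also have "\<dots> \<longleftrightarrow> (\<forall>F. finite F \<and> F \<subseteq> carrier M \<longrightarrow> (\<exists>E. finite E \<and> E \<subseteq> carrier M \<and>
        (\<forall>x\<in>configs M A. \<forall>y\<in>configs M A.
           (\<forall>m\<in>E. x m = y m) \<longrightarrow> (\<forall>m\<in>F. \<tau> x m = \<tau> y m))))"
    unfolding eventually_prodiscrete Ball_def split_paired_All mem_Collect_eq case_prod_conv agree
    using funcset_mem[OF True] by (intro all_cong ex_cong conj_cong HOL.refl) blast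
  finally show ?thesis
    by (simp add: cellular_automaton_def)
qed (simp add: cellular_automaton_def)

lemma surjunctive_finite_alphabet:
  fixes A :: "'b set"
  assumes M: "monoid M" and surj: "surjunctive M" and fin: "finite A"
    and ca: "cellular_automaton M A \<tau>" and inj: "inj_on \<tau> (configs M A)"
  shows "\<tau> ` configs M A = configs M A"
proof -
  interpret monoid M by fact
  obtain f :: "'b \<Rightarrow> nat" where f: "inj_on f A"
    using finite_imp_inj_to_nat_seg[OF fin] by blast
  define B where "B = f ` A"
  define g where "g = inv_into A f"
  have fB: "f a \<in> B" "g (f a) = a" if "a \<in> A" for a
    using that f by (auto simp: B_def g_def)
  have gA: "g b \<in> A" "f (g b) = b" if "b \<in> B" for b
    using that by (auto simp: B_def g_def inv_into_into f_inv_into_f)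
  define \<Phi> where "\<Phi> x = (\<lambda>m\<in>carrier M. f (x m))" for x
  define \<Psi> where "\<Psi> x = (\<lambda>m\<in>carrier M. g (x m))" for x
  have \<Phi>: "\<Phi> x \<in> configs M B" "\<Psi> (\<Phi> x) = x" if "x \<in> configs M A" for x
    using that fB by (auto simp: configs_def \<Phi>_def \<Psi>_def fun_eq_iff PiE_iff extensional_def)
  have \<Psi>: "\<Psi> x \<in> configs M A" "\<Phi> (\<Psi> x) = x" if "x \<in> configs M B" for x
    using that gA by (auto simp: configs_def \<Phi>_def \<Psi>_def fun_eq_iff PiE_iff extensional_def)
  have sh: "\<Phi> (shift M m x) = shift M m (\<Phi> x)" "\<Psi> (shift M m y) = shift M m (\<Psi> y)"
    if "m \<in> carrier M" for m x y
    using that by (auto simp: \<Phi>_def \<Psi>_def shift_def fun_eq_iff)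
  have \<tau>: "\<tau> x \<in> configs M A" if "x \<in> configs M A" for x
    using ca that by (auto simp: cellular_automaton_def)
  have eqv: "\<tau> (shift M m x) = shift M m (\<tau> x)"
    if "m \<in> carrier M" "x \<in> configs M A" for m x
    using ca that by (auto simp: cellular_automaton_def)
  define \<sigma> where "\<sigma> x = \<Phi> (\<tau> (\<Psi> x))" for x
  have "cellular_automaton M B \<sigma>"
    unfolding cellular_automaton_alt
  proof (intro conjI ballI allI impI)
    show "\<sigma> \<in> configs M B \<rightarrow> configs M B"
      by (auto simp: \<sigma>_def \<Phi> \<Psi> \<tau>)
    show "\<sigma> (shift M m x) = shift M m (\<sigma> x)"
      if "m \<in> carrier M" "x \<in> configs M B" for m x
      using that by (simp add: \<sigma>_def sh eqv \<Psi>)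
    fix F assume F: "finite F \<and> F \<subseteq> carrier M"
    then have "\<exists>E. finite E \<and> E \<subseteq> carrier M \<and> (\<forall>x\<in>configs M A. \<forall>y\<in>configs M A.
        (\<forall>m\<in>E. x m = y m) \<longrightarrow> (\<forall>m\<in>F. \<tau> x m = \<tau> y m))"
      using conjunct2[OF conjunct2[OF ca[unfolded cellular_automaton_alt]]] by simp
    then obtain E where E: "finite E" "E \<subseteq> carrier M"
      and EF: "\<forall>x\<in>configs M A. \<forall>y\<in>configs M A.
        (\<forall>m\<in>E. x m = y m) \<longrightarrow> (\<forall>m\<in>F. \<tau> x m = \<tau> y m)"
      by (elim exE conjE)
    have "\<forall>m\<in>F. \<sigma> x m = \<sigma> y m"
      if "x \<in> configs M B" "y \<in> configs M B" "\<forall>m\<in>E. x m = y m" for x y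
    proof -
      have "\<forall>m\<in>E. \<Psi> x m = \<Psi> y m"
        using that(3) by (simp add: \<Psi>_def restrict_def)
      with bspec[OF bspec[OF EF \<Psi>(1)[OF that(1)]] \<Psi>(1)[OF that(2)]]
      have "\<forall>m\<in>F. \<tau> (\<Psi> x) m = \<tau> (\<Psi> y) m"
        by (rule mp)
      then show ?thesis
        by (simp add: \<sigma>_def \<Phi>_def restrict_def)
    qed
    then show "\<exists>E. finite E \<and> E \<subseteq> carrier M \<and> (\<forall>x\<in>configs M B. \<forall>y\<in>configs M B.
        (\<forall>m\<in>E. x m = y m) \<longrightarrow> (\<forall>m\<in>F. \<sigma> x m = \<sigma> y m))"
      using E by blast
  qed
  moreover have "inj_on \<sigma> (configs M B)"
  proof (rule inj_onI)
    fix x y assume xy: "x \<in> configs M B" "y \<in> configs M B" "\<sigma> x = \<sigma> y"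
    then have "\<tau> (\<Psi> x) = \<tau> (\<Psi> y)"
      by (metis \<sigma>_def \<Phi>(2) \<Psi>(1) \<tau>)
    then show "x = y"
      using inj xy by (metis \<Psi> inj_onD)
  qed
  moreover have "finite B"
    using fin by (simp add: B_def)
  ultimately have \<sigma>: "\<sigma> ` configs M B = configs M B"
    using surj by (auto simp: surjunctive_def)
  have "y \<in> \<tau> ` configs M A" if y: "y \<in> configs M A" for y
  proof -
    obtain x where x: "x \<in> configs M B" "\<sigma> x = \<Phi> y"
      using \<sigma> \<Phi>(1)[OF y] by (metis imageE)
    then have "\<tau> (\<Psi> x) = y"
      by (metis \<sigma>_def \<Phi>(2) \<Psi>(1) \<tau> y)
    then show ?thesis
      using \<Psi>(1)[OF x(1)] by blast
  qed
  then show ?thesis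
    using \<tau> by blast
qed

end

theory Submission
  imports Defs
begin

text \<open>If \<open>p q = 1 \<noteq> q p\<close> in \<open>M\<close>, then \<open>x \<mapsto> (m \<mapsto> x (p m))\<close> is a cellular automaton with left
  inverse \<open>x \<mapsto> (m \<mapsto> x (q m))\<close>, hence injective. Were it surjective, that left inverse would also
  be a right inverse, and then \<open>x (q p) = x 1\<close> for every configuration \<open>x\<close>. In the bicyclic monoid
  \<open>y x \<noteq> 1\<close>, because \<open>x\<close> and \<open>y\<close> can act on the natural numbers as predecessor and successor.\<close>

definition left_translate :: "('a, 'm) monoid_scheme \<Rightarrow> 'a \<Rightarrow> ('a \<Rightarrow> 'b) \<Rightarrow> 'a \<Rightarrow> 'b" where
  "left_translate M s x = (\<lambda>m\<in>carrier M. x (s \<otimes>\<^bsub>M\<^esub> m))"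

context monoid
begin

lemma left_translate_configs:
  assumes "s \<in> carrier G" "x \<in> configs G A"
  shows "left_translate G s x \<in> configs G A"
  using assms by (auto simp: configs_def left_translate_def PiE_iff)

text \<open>Composition reverses the factors: the outer translation moves the argument by
  \<open>s\<close> first, and the inner one then puts \<open>t\<close> to its left. So
  \<open>p \<otimes> q = \<one>\<close> makes translation by \<open>q\<close> a left inverse of
  translation by \<open>p\<close>.\<close>

lemma left_translate_left_translate:
  assumes "s \<in> carrier G" "t \<in> carrier G"
  shows "left_translate G s (left_translate G t x) = left_translate G (t \<otimes> s) x"
  using assms by (auto simp: left_translate_def fun_eq_iff m_assoc)

lemma left_translate_one: "x \<in> configs G A \<Longrightarrow> left_translate G \<one> x = x"
  by (auto simp: left_translate_def fun_eq_iff configs_def PiE_iff extensional_def)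

text \<open>Equivariance is associativity, since \<open>shift\<close> multiplies the argument on the
  right and \<open>left_translate\<close> on the left.\<close>

lemma cellular_automaton_left_translate:
  assumes s: "s \<in> carrier G"
  shows "cellular_automaton G A (left_translate G s)"
  unfolding cellular_automaton_alt
proof (intro conjI ballI allI impI)
  show "left_translate G s \<in> configs G A \<rightarrow> configs G A"
    using s by (simp add: left_translate_configs)
  show "left_translate G s (shift G m x) = shift G m (left_translate G s x)"
    if "m \<in> carrier G" for m x
    using s that by (auto simp: left_translate_def shift_def fun_eq_iff m_assoc)
  show "\<exists>E. finite E \<and> E \<subseteq> carrier G \<and> (\<forall>x\<in>configs G A. \<forall>y\<in>configs G A.
      (\<forall>m\<in>E. x m = y m) \<longrightarrow> (\<forall>m\<in>F. left_translate G s x m = left_translate G s y m))"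
    if "finite F \<and> F \<subseteq> carrier G" for F
    \<comment> \<open>The image on \<open>F\<close> only reads the original configuration on the
      finite set \<open>s F\<close>.\<close>
    using that s
    by (intro exI[of _ "(\<lambda>m. s \<otimes> m) ` F"]) (auto simp: left_translate_def)
qed

lemma not_surjunctive_if_one_sided_inverse:
  assumes p: "p \<in> carrier G" and q: "q \<in> carrier G"
    and pq: "p \<otimes> q = \<one>" and qp: "q \<otimes> p \<noteq> \<one>"
  shows "\<not> surjunctive G"
proof
  assume "surjunctive G"
  let ?C = "configs G {0, 1 :: nat}"
  have left_inv: "left_translate G q (left_translate G p x) = x" if "x \<in> ?C" for x
    using that p q by (simp add: left_translate_left_translate pq left_translate_one[OF that])
  then have "inj_on (left_translate G p) ?C"
    by (rule inj_on_inverseI[where g = "left_translate G q"])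
  then have surj: "left_translate G p ` ?C = ?C"
    using \<open>surjunctive G\<close> cellular_automaton_left_translate[OF p, of "{0, 1 :: nat}"]
    by (simp add: surjunctive_def)
  \<comment> \<open>The indicator of \<open>\<one>\<close> takes different values at
    \<open>\<one>\<close> and at \<open>q \<otimes> p\<close>.\<close>
  define x where "x = (\<lambda>m\<in>carrier G. if m = \<one> then 1 else 0 :: nat)"
  have "x \<in> left_translate G p ` ?C"
    unfolding surj by (auto simp: x_def configs_def)
  then obtain z where z: "z \<in> ?C" "x = left_translate G p z"
    by (elim imageE)
  have "left_translate G (q \<otimes> p) x = left_translate G p (left_translate G q x)"
    using p q by (simp add: left_translate_left_translate)
  \<comment> \<open>With \<open>x\<close> the translate of \<open>z\<close> by \<open>p\<close>,
    translating \<open>x\<close> by \<open>q\<close> gives back \<open>z\<close>.\<close>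
  also have "\<dots> = x"
    using z left_inv by simp
  finally have "left_translate G (q \<otimes> p) x \<one> = x \<one>"
    by (rule fun_cong)
  then show False
    using p q qp by (simp add: x_def left_translate_def)
qed

end

text \<open>The first letter acts last. Subtraction is truncated, so \<open>X\<close> undoes
  \<open>Y\<close> everywhere, while \<open>Y\<close> fails to undo \<open>X\<close> at 0.\<close>

fun word_act :: "bicyclic_gen list \<Rightarrow> nat \<Rightarrow> nat" where
  "word_act [] n = n"
| "word_act (X # w) n = word_act w n - 1"
| "word_act (Y # w) n = Suc (word_act w n)"

lemma word_act_append: "word_act (u @ v) n = word_act u (word_act v n)"
  by (induction u n rule: word_act.induct) auto

text \<open>The defining relation holds because \<open>Suc n - 1 = n\<close>, and
  \<open>word_act_append\<close> makes equality of actions compatible with concatenation.\<close>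

lemma word_act_cong:
  "(u, v) \<in> word_cong {([X, Y], [])} \<Longrightarrow> word_act u = word_act v"
  by (induction rule: word_cong.induct) (auto simp: fun_eq_iff word_act_append)

lemma bicyclic_one_sided_inverse:
  obtains p q where "p \<in> carrier bicyclic_monoid" "q \<in> carrier bicyclic_monoid"
    "p \<otimes>\<^bsub>bicyclic_monoid\<^esub> q = \<one>\<^bsub>bicyclic_monoid\<^esub>"
    "q \<otimes>\<^bsub>bicyclic_monoid\<^esub> p \<noteq> \<one>\<^bsub>bicyclic_monoid\<^esub>"
proof -
  let ?R = "{([X, Y], [])}"
  let ?c = "\<lambda>w. word_cong ?R `` {w}"
  have carrier: "?c w \<in> carrier bicyclic_monoid" for w
    by (auto simp: bicyclic_monoid_def presented_monoid_def quotient_def)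
  have one: "\<one>\<^bsub>bicyclic_monoid\<^esub> = ?c []"
    by (simp add: bicyclic_monoid_def presented_monoid_def)
  have mult: "?c u \<otimes>\<^bsub>bicyclic_monoid\<^esub> ?c v = ?c (u @ v)" for u v
    by (simp add: bicyclic_monoid_def presented_monoid_mult)
  have "?c [X, Y] = ?c []"
    by (intro equiv_class_eq[OF equiv_word_cong] word_cong.rel) simp
  moreover have "?c [Y, X] \<noteq> ?c []"
  proof
    assume "?c [Y, X] = ?c []"
    then have "([Y, X], []) \<in> word_cong ?R"
      by (rule eq_equiv_class[OF _ equiv_word_cong]) simp
    \<comment> \<open>The left side is 1, since \<open>X\<close> fixes 0, and the right side is
      0.\<close>
    then have "word_act [Y, X] 0 = word_act [] 0"
      by (simp only: word_act_cong)
    then show False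
      by simp
  qed
  ultimately show thesis
    by (intro that[of "?c [X]" "?c [Y]"]) (simp_all add: carrier one mult)
qed

lemma not_surjunctive_bicyclic_submonoid:
  assumes "monoid M" and N: "submonoid N M"
    and iso: "M\<lparr>carrier := N\<rparr> \<cong> bicyclic_monoid"
  shows "\<not> surjunctive M"
proof -
  interpret M: monoid M by fact
  interpret B: monoid bicyclic_monoid by (rule monoid_bicyclic_monoid)
  obtain h where h: "h \<in> iso (M\<lparr>carrier := N\<rparr>) bicyclic_monoid"
    using iso by (auto simp: is_iso_def)
  have N_sub: "n \<in> carrier M" if "n \<in> N" for n
    using submonoid.subset[OF N] that by blast
  have one_N: "\<one>\<^bsub>M\<^esub> \<in> N"
    by (rule submonoid.one_closed[OF N])
  have h_mem: "h a \<in> carrier bicyclic_monoid" if "a \<in> N" for a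
    using h that by (auto simp: iso_def hom_def)
  have h_mult: "h (a \<otimes>\<^bsub>M\<^esub> b) = h a \<otimes>\<^bsub>bicyclic_monoid\<^esub> h b" if "a \<in> N" "b \<in> N" for a b
    using h that by (auto simp: iso_def hom_def)
  have h_inj: "inj_on h N" and h_surj: "h ` N = carrier bicyclic_monoid"
    using h by (simp_all add: iso_def bij_betw_def)
  \<comment> \<open>\<open>iso\<close> demands only multiplicativity, so preservation of the unit
    comes from surjectivity: \<open>h\<close> applied to the product of the unit of \<open>M\<close>
    with \<open>e\<close> gives it.\<close>
  obtain e where e: "e \<in> N" "h e = \<one>\<^bsub>bicyclic_monoid\<^esub>"
    using B.one_closed unfolding h_surj[symmetric] by auto
  have h_one: "h \<one>\<^bsub>M\<^esub> = \<one>\<^bsub>bicyclic_monoid\<^esub>"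
    using h_mult[OF one_N e(1)] e N_sub h_mem[OF one_N] by simp
  obtain p' q' where pq': "p' \<in> h ` N" "q' \<in> h ` N"
    "p' \<otimes>\<^bsub>bicyclic_monoid\<^esub> q' = \<one>\<^bsub>bicyclic_monoid\<^esub>"
    "q' \<otimes>\<^bsub>bicyclic_monoid\<^esub> p' \<noteq> \<one>\<^bsub>bicyclic_monoid\<^esub>"
    unfolding h_surj by (rule bicyclic_one_sided_inverse)
  then obtain p q where pq: "p \<in> N" "q \<in> N" "p' = h p" "q' = h q"
    by (elim imageE)
  show ?thesis
  proof (rule M.not_surjunctive_if_one_sided_inverse)
    show "p \<in> carrier M" "q \<in> carrier M"
      using pq by (simp_all add: N_sub)
    have "h (p \<otimes>\<^bsub>M\<^esub> q) = h \<one>\<^bsub>M\<^esub>"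
      using pq pq' by (simp add: h_mult h_one)
    then show "p \<otimes>\<^bsub>M\<^esub> q = \<one>\<^bsub>M\<^esub>"
      by (rule inj_onD[OF h_inj _ submonoid.m_closed[OF N pq(1,2)] one_N])
    have "h (q \<otimes>\<^bsub>M\<^esub> p) \<noteq> h \<one>\<^bsub>M\<^esub>"
      using pq pq' by (simp add: h_mult h_one)
    then show "q \<otimes>\<^bsub>M\<^esub> p \<noteq> \<one>\<^bsub>M\<^esub>"
      by (rule contrapos_nn) (rule arg_cong)
  qed
qed

theorem theorem5p5:
  shows "(\<forall>M :: ('a, 'm) monoid_scheme.
            monoid M \<longrightarrow>
            (\<exists>N. submonoid N M \<and> M\<lparr>carrier := N\<rparr> \<cong> bicyclic_monoid) \<longrightarrow>
            \<not> surjunctive M)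
         \<and> \<not> surjunctive bicyclic_monoid"
proof
  show "\<forall>M :: ('a, 'm) monoid_scheme. monoid M \<longrightarrow>
      (\<exists>N. submonoid N M \<and> M\<lparr>carrier := N\<rparr> \<cong> bicyclic_monoid) \<longrightarrow> \<not> surjunctive M"
    using not_surjunctive_bicyclic_submonoid by blast
  \<comment> \<open>The first conjunct concerns the fixed carrier type \<open>'a\<close>, so it
    cannot be specialised here; the one-sided inverses are used directly.\<close>
  show "\<not> surjunctive bicyclic_monoid"
    by (rule bicyclic_one_sided_inverse)
      (rule monoid.not_surjunctive_if_one_sided_inverse[OF monoid_bicyclic_monoid])
qed

end
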